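(* There is an absolute constant $C$ such that for all positive integers $n$ and $k$ there is a CNF encoding of $\mathsf{AtMostK}(x_1,\dots,x_n)$ using at most $2n + C k n^{k/(k+1)}$ clauses and at most $C k n^{k/(k+1)}$ auxiliary variables.
   Context: $\mathsf{AtMostK}(x_1,\dots,x_n)$ is true iff at most $k$ of $x_1,\dots,x_n$ are true. A CNF formula is a set of clauses; its size is its number of clauses. For a partial assignment $\tau$, $\varphi|_\tau$ deletes clauses satisfied by $\tau$ and literals falsified by $\tau$. A CNF $\varphi$ over $X\sqcup Y$, $X=(x_1,\dots,x_n)$, encodes $f$ if for every assignment $\tau$ of $X$, $f(\tau)=\top$ iff $\varphi|_\tau$ is satisfiable; variables in $Y$ are auxiliary. *)

theory Defs
  imports Complex_Main
begin

datatype 'v lit = Pos 'v | Neg 'v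

primrec lit_var :: "'v lit \<Rightarrow> 'v" where
  "lit_var (Pos v) = v"
| "lit_var (Neg v) = v"

type_synonym 'v clause = "'v lit set"
type_synonym 'v cnf = "'v clause set"

definition is_cnf :: "'v cnf \<Rightarrow> bool" where
  "is_cnf \<phi> \<longleftrightarrow> finite \<phi> \<and> (\<forall>C\<in>\<phi>. finite C)"

definition cnf_vars :: "'v cnf \<Rightarrow> 'v set" where
  "cnf_vars \<phi> = (\<Union>C\<in>\<phi>. lit_var ` C)"

text \<open>A partial assignment is a map; a literal whose variable is outside its domain is neither
  satisfied nor falsified.\<close>

primrec lit_satisfied :: "('v \<rightharpoonup> bool) \<Rightarrow> 'v lit \<Rightarrow> bool" where
  "lit_satisfied \<tau> (Pos v) \<longleftrightarrow> \<tau> v = Some True"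
| "lit_satisfied \<tau> (Neg v) \<longleftrightarrow> \<tau> v = Some False"

primrec lit_falsified :: "('v \<rightharpoonup> bool) \<Rightarrow> 'v lit \<Rightarrow> bool" where
  "lit_falsified \<tau> (Pos v) \<longleftrightarrow> \<tau> v = Some False"
| "lit_falsified \<tau> (Neg v) \<longleftrightarrow> \<tau> v = Some True"

definition clause_satisfied :: "('v \<rightharpoonup> bool) \<Rightarrow> 'v clause \<Rightarrow> bool" where
  "clause_satisfied \<tau> C \<longleftrightarrow> (\<exists>l\<in>C. lit_satisfied \<tau> l)"

definition cnf_restrict :: "'v cnf \<Rightarrow> ('v \<rightharpoonup> bool) \<Rightarrow> 'v cnf" where
  "cnf_restrict \<phi> \<tau> = {{l \<in> C. \<not> lit_falsified \<tau> l} | C. C \<in> \<phi> \<and> \<not> clause_satisfied \<tau> C}"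

definition satisfiable :: "'v cnf \<Rightarrow> bool" where
  "satisfiable \<phi> \<longleftrightarrow> (\<exists>\<sigma> :: 'v \<Rightarrow> bool. \<forall>C\<in>\<phi>. clause_satisfied (\<lambda>v. Some (\<sigma> v)) C)"

text \<open>The list \<open>xs\<close> holds the input variables, in order, and \<open>Y\<close> is the set of auxiliary
  variables. A Boolean function is applied to the list of values of its arguments.\<close>

definition encodes :: "'v cnf \<Rightarrow> 'v list \<Rightarrow> 'v set \<Rightarrow> (bool list \<Rightarrow> bool) \<Rightarrow> bool" where
  "encodes \<phi> xs Y f \<longleftrightarrow>
     is_cnf \<phi> \<and> distinct xs \<and> finite Y \<and> set xs \<inter> Y = {} \<and> cnf_vars \<phi> \<subseteq> set xs \<union> Y \<and>
     (\<forall>\<tau> :: 'v \<rightharpoonup> bool. dom \<tau> = set xs \<longrightarrow>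
        (f (map (\<lambda>x. the (\<tau> x)) xs) \<longleftrightarrow> satisfiable (cnf_restrict \<phi> \<tau>)))"

definition AtMost :: "nat \<Rightarrow> bool list \<Rightarrow> bool" where
  "AtMost k bs \<longleftrightarrow> card {i. i < length bs \<and> bs ! i} \<le> k"

end

theory Submission
  imports Defs "HOL-Library.FuncSet"
begin

text \<open>
  Place the inputs at points of a grid of dimension \<open>k + 1\<close> and side \<open>m\<close> with \<open>m ^ (k + 1) \<ge> n\<close>.
  Two clauses per input say that its point lies on a selected line of direction \<open>0\<close> and on a
  selected line of some direction \<open>d \<in> {1..k}\<close>. It is further required that at most \<open>k\<close> lines of the
  second kind are selected and that each of them meets at most one selected line of the first kind.
  These two requirements cost \<open>O(k m ^ k)\<close> clauses and force at most \<open>k\<close> true inputs.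
  Conversely, given at most \<open>k\<close> true points, select the lines of direction \<open>0\<close> through them. For a
  true point \<open>s\<close>, each of the at most \<open>k - 1\<close> other points spoils at most one direction \<open>d\<close>, namely
  when it differs from \<open>s\<close> in \<open>d\<close> and nowhere else outside \<open>0\<close>; so some direction is good for \<open>s\<close>.

  With \<open>m = \<lceil>n powr (1 / (k + 1))\<rceil>\<close>, rounding costs only a constant factor in \<open>m ^ k\<close> if
  \<open>n powr (1 / (k + 1)) \<ge> k\<close>. Otherwise \<open>n \<le> k * n powr (k / (k + 1))\<close>, and an encoding with \<open>O(n)\<close>
  clauses is enough. Such an encoding, which also bounds the number of selected lines, comes from
  writing the sum as \<open>p + 2 * c\<close> with a chain of full adders and recursing on the carry bits.
\<close>

section \<open>Total assignments as models, and cardinality encodings in terms of them\<close>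

definition models :: "('v \<Rightarrow> bool) \<Rightarrow> 'v cnf \<Rightarrow> bool" where
  "models \<sigma> \<phi> \<longleftrightarrow> (\<forall>C\<in>\<phi>. clause_satisfied (\<lambda>v. Some (\<sigma> v)) C)"

lemma models_empty [simp]: "models \<sigma> {}"
  by (simp add: models_def)

lemma models_insert [simp]:
  "models \<sigma> (insert C \<phi>) \<longleftrightarrow> clause_satisfied (\<lambda>v. Some (\<sigma> v)) C \<and> models \<sigma> \<phi>"
  by (simp add: models_def)

lemma models_Un [simp]: "models \<sigma> (\<phi> \<union> \<psi>) \<longleftrightarrow> models \<sigma> \<phi> \<and> models \<sigma> \<psi>"
  by (auto simp: models_def)

lemma models_image:
  "models \<sigma> (f ` I) \<longleftrightarrow> (\<forall>i\<in>I. clause_satisfied (\<lambda>v. Some (\<sigma> v)) (f i))"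
  by (simp add: models_def)

lemma clause_satisfied_empty [simp]: "\<not> clause_satisfied \<tau> {}"
  by (simp add: clause_satisfied_def)

lemma clause_satisfied_insert [simp]:
  "clause_satisfied \<tau> (insert l C) \<longleftrightarrow> lit_satisfied \<tau> l \<or> clause_satisfied \<tau> C"
  by (simp add: clause_satisfied_def)

lemma clause_satisfied_image:
  "clause_satisfied \<tau> (f ` I) \<longleftrightarrow> (\<exists>i\<in>I. lit_satisfied \<tau> (f i))"
  by (simp add: clause_satisfied_def)

lemma is_cnf_simps [simp]:
  "is_cnf {}"
  "is_cnf (insert C \<phi>) \<longleftrightarrow> finite C \<and> is_cnf \<phi>"
  "is_cnf (\<phi> \<union> \<psi>) \<longleftrightarrow> is_cnf \<phi> \<and> is_cnf \<psi>"
  by (auto simp: is_cnf_def)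

lemma cnf_vars_simps [simp]:
  "cnf_vars {} = {}"
  "cnf_vars (insert C \<phi>) = lit_var ` C \<union> cnf_vars \<phi>"
  "cnf_vars (\<phi> \<union> \<psi>) = cnf_vars \<phi> \<union> cnf_vars \<psi>"
  by (auto simp: cnf_vars_def)

lemma models_cong:
  assumes "\<And>v. v \<in> cnf_vars \<phi> \<Longrightarrow> \<sigma> v = \<sigma>' v"
  shows "models \<sigma> \<phi> \<longleftrightarrow> models \<sigma>' \<phi>"
proof -
  have "lit_satisfied (\<lambda>v. Some (\<sigma> v)) l \<longleftrightarrow> lit_satisfied (\<lambda>v. Some (\<sigma>' v)) l"
    if "C \<in> \<phi>" "l \<in> C" for C l
  proof -
    have "lit_var l \<in> cnf_vars \<phi>"
      using that by (auto simp: cnf_vars_def)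
    then have "\<sigma> (lit_var l) = \<sigma>' (lit_var l)"
      by (rule assms)
    then show ?thesis
      by (cases l) auto
  qed
  then show ?thesis
    by (auto simp: models_def clause_satisfied_def)
qed

text \<open>This replaces restricted formulas by total assignments extending \<open>\<tau>\<close>.
  From left to right, the satisfying assignment is overwritten by \<open>\<tau>\<close>: clauses
  satisfied by \<open>\<tau>\<close> stay satisfied, and in every other clause the true surviving
  literal is neither satisfied nor falsified by \<open>\<tau>\<close>, so its variable lies outside
  the domain and keeps its value.\<close>

lemma satisfiable_cnf_restrict_iff:
  "satisfiable (cnf_restrict \<phi> \<tau>) \<longleftrightarrow>
     (\<exists>\<sigma>. (\<forall>v b. \<tau> v = Some b \<longrightarrow> \<sigma> v = b) \<and> models \<sigma> \<phi>)"
proof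
  assume "satisfiable (cnf_restrict \<phi> \<tau>)"
  then obtain \<sigma> where \<sigma>: "\<And>C. C \<in> cnf_restrict \<phi> \<tau> \<Longrightarrow> clause_satisfied (\<lambda>v. Some (\<sigma> v)) C"
    by (auto simp: satisfiable_def)
  define \<sigma>' where "\<sigma>' v = (case \<tau> v of Some b \<Rightarrow> b | None \<Rightarrow> \<sigma> v)" for v
  have "clause_satisfied (\<lambda>v. Some (\<sigma>' v)) C" if "C \<in> \<phi>" for C
  proof (cases "clause_satisfied \<tau> C")
    case True
    then obtain l where "l \<in> C" "lit_satisfied \<tau> l"
      by (auto simp: clause_satisfied_def)
    moreover from this have "lit_satisfied (\<lambda>v. Some (\<sigma>' v)) l"
      by (cases l) (auto simp: \<sigma>'_def)
    ultimately show ?thesis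
      by (auto simp: clause_satisfied_def)
  next
    case False
    then have "{l \<in> C. \<not> lit_falsified \<tau> l} \<in> cnf_restrict \<phi> \<tau>"
      using that by (auto simp: cnf_restrict_def)
    from \<sigma>[OF this] obtain l where l: "l \<in> C" "\<not> lit_falsified \<tau> l" "lit_satisfied (\<lambda>v. Some (\<sigma> v)) l"
      by (auto simp: clause_satisfied_def)
    moreover have "\<not> lit_satisfied \<tau> l"
      using False l by (auto simp: clause_satisfied_def)
    ultimately have "lit_satisfied (\<lambda>v. Some (\<sigma>' v)) l"
      by (cases l) (auto simp: \<sigma>'_def split: option.split)
    then show ?thesis
      using l by (auto simp: clause_satisfied_def)
  qed
  then have "models \<sigma>' \<phi>"
    by (simp add: models_def)
  moreover have "\<forall>v b. \<tau> v = Some b \<longrightarrow> \<sigma>' v = b"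
    by (simp add: \<sigma>'_def)
  ultimately show "\<exists>\<sigma>. (\<forall>v b. \<tau> v = Some b \<longrightarrow> \<sigma> v = b) \<and> models \<sigma> \<phi>"
    by blast
next
  assume "\<exists>\<sigma>. (\<forall>v b. \<tau> v = Some b \<longrightarrow> \<sigma> v = b) \<and> models \<sigma> \<phi>"
  then obtain \<sigma> where ext: "\<And>v b. \<tau> v = Some b \<Longrightarrow> \<sigma> v = b" and \<sigma>: "models \<sigma> \<phi>"
    by blast
  have "clause_satisfied (\<lambda>v. Some (\<sigma> v)) {l \<in> C. \<not> lit_falsified \<tau> l}" if "C \<in> \<phi>" for C
  proof -
    from \<sigma> that obtain l where l: "l \<in> C" "lit_satisfied (\<lambda>v. Some (\<sigma> v)) l"
      by (auto simp: models_def clause_satisfied_def)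
    then have "\<not> lit_falsified \<tau> l"
      by (cases l) (auto dest: ext)
    with l show ?thesis
      by (auto simp: clause_satisfied_def)
  qed
  then show "satisfiable (cnf_restrict \<phi> \<tau>)"
    by (auto simp: satisfiable_def cnf_restrict_def)
qed

lemma AtMost_map_iff:
  assumes "distinct xs"
  shows "AtMost k (map f xs) \<longleftrightarrow> card {v \<in> set xs. f v} \<le> k"
proof -
  have "{v \<in> set xs. f v} = (!) xs ` {i. i < length xs \<and> f (xs ! i)}"
    by (auto simp: in_set_conv_nth)
  moreover have "inj_on ((!) xs) {i. i < length xs \<and> f (xs ! i)}"
    using assms by (auto simp: inj_on_def nth_eq_iff_index_eq)
  moreover have "{i. i < length (map f xs) \<and> map f xs ! i} = {i. i < length xs \<and> f (xs ! i)}"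
    by auto
  ultimately show ?thesis
    by (simp add: AtMost_def card_image)
qed

text \<open>Completeness asks for a model that agrees with the given assignment everywhere outside
  \<open>Y\<close>, not only on \<open>X\<close>. Encodings with disjoint auxiliary variables can
  therefore be satisfied one after the other.\<close>

definition encodes_at_most :: "'v cnf \<Rightarrow> 'v set \<Rightarrow> 'v set \<Rightarrow> nat \<Rightarrow> bool" where
  "encodes_at_most \<phi> X Y k \<longleftrightarrow>
     is_cnf \<phi> \<and> finite Y \<and> X \<inter> Y = {} \<and> cnf_vars \<phi> \<subseteq> X \<union> Y \<and>
     (\<forall>\<sigma>. models \<sigma> \<phi> \<longrightarrow> card {v \<in> X. \<sigma> v} \<le> k) \<and>
     (\<forall>\<sigma>. card {v \<in> X. \<sigma> v} \<le> k \<longrightarrow> (\<exists>\<sigma>'. (\<forall>v. v \<notin> Y \<longrightarrow> \<sigma>' v = \<sigma> v) \<and> models \<sigma>' \<phi>))"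

lemma encodes_at_most_extend:
  assumes "encodes_at_most \<phi> X Y k" "card {v \<in> X. \<sigma> v} \<le> k"
  obtains \<sigma>' where "\<And>v. v \<notin> Y \<Longrightarrow> \<sigma>' v = \<sigma> v" "models \<sigma>' \<phi>"
proof -
  have "\<forall>\<sigma>. card {v \<in> X. \<sigma> v} \<le> k \<longrightarrow> (\<exists>\<sigma>'. (\<forall>v. v \<notin> Y \<longrightarrow> \<sigma>' v = \<sigma> v) \<and> models \<sigma>' \<phi>)"
    using assms(1) by (simp add: encodes_at_most_def)
  from this[rule_format, OF assms(2)] show thesis
    using that by auto
qed

lemma encodes_at_most_imp_encodes:
  assumes \<phi>: "encodes_at_most \<phi> (set xs) Y k" and "distinct xs"
  shows "encodes \<phi> xs Y (AtMost k)"
proof -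
  have "card {v \<in> set xs. the (\<tau> v)} \<le> k \<longleftrightarrow>
      (\<exists>\<sigma>. (\<forall>v b. \<tau> v = Some b \<longrightarrow> \<sigma> v = b) \<and> models \<sigma> \<phi>)" (is "?L \<longleftrightarrow> ?R")
    if dom: "dom \<tau> = set xs" for \<tau>
  proof
    assume ?L
    \<comment> \<open>Outside the inputs \<open>the (\<tau> v)\<close> is an unspecified value,
      which is harmless because only the values on \<open>set xs\<close> are compared.\<close>
    then obtain \<sigma> where \<sigma>: "\<And>v. v \<notin> Y \<Longrightarrow> \<sigma> v = the (\<tau> v)" "models \<sigma> \<phi>"
      using encodes_at_most_extend[OF \<phi>, of "\<lambda>v. the (\<tau> v)"] by blast
    have "\<sigma> v = b" if "\<tau> v = Some b" for v b
    proof -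
      have "v \<in> set xs"
        using that dom by blast
      then have "v \<notin> Y"
        using \<phi> by (auto simp: encodes_at_most_def)
      then show ?thesis
        using \<sigma>(1) that by simp
    qed
    then show ?R
      using \<sigma>(2) by blast
  next
    assume ?R
    then obtain \<sigma> where ext: "\<And>v b. \<tau> v = Some b \<Longrightarrow> \<sigma> v = b" and \<sigma>: "models \<sigma> \<phi>"
      by blast
    have "card {v \<in> set xs. \<sigma> v} \<le> k"
      using \<phi> \<sigma> by (simp add: encodes_at_most_def)
    moreover have "{v \<in> set xs. \<sigma> v} = {v \<in> set xs. the (\<tau> v)}"
      unfolding dom[symmetric] by (auto dest: ext)
    ultimately show ?L
      by simp
  qed
  then have "AtMost k (map (\<lambda>x. the (\<tau> x)) xs) \<longleftrightarrow> satisfiable (cnf_restrict \<phi> \<tau>)"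
    if "dom \<tau> = set xs" for \<tau>
    using that unfolding AtMost_map_iff[OF \<open>distinct xs\<close>] satisfiable_cnf_restrict_iff .
  moreover have "is_cnf \<phi>" "finite Y" "set xs \<inter> Y = {}" "cnf_vars \<phi> \<subseteq> set xs \<union> Y"
    using \<phi> by (simp_all add: encodes_at_most_def)
  ultimately show ?thesis
    using \<open>distinct xs\<close> unfolding encodes_def by (intro conjI allI impI)
qed

section \<open>A linear-size encoding\<close>

text \<open>The variable \<open>p\<close> is the final sum bit and \<open>C\<close> the set of carries. Models only need to bound the
  sum from above, so the adder clauses state one direction of each equivalence.\<close>

definition encodes_half_sum :: "'v cnf \<Rightarrow> 'v set \<Rightarrow> 'v set \<Rightarrow> 'v set \<Rightarrow> 'v \<Rightarrow> bool" where
  "encodes_half_sum \<phi> X Y C p \<longleftrightarrow>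
    is_cnf \<phi> \<and> finite Y \<and> C \<subseteq> Y \<and> p \<in> Y \<and> p \<notin> C \<and> cnf_vars \<phi> \<subseteq> X \<union> Y \<and>
    (\<forall>\<sigma>. models \<sigma> \<phi> \<longrightarrow> card {v \<in> X. \<sigma> v} \<le> of_bool (\<sigma> p) + 2 * card {v \<in> C. \<sigma> v}) \<and>
    (\<forall>\<sigma>. \<exists>\<sigma>'. (\<forall>v. v \<notin> Y \<longrightarrow> \<sigma>' v = \<sigma> v) \<and> models \<sigma>' \<phi> \<and>
       card {v \<in> X. \<sigma> v} = of_bool (\<sigma>' p) + 2 * card {v \<in> C. \<sigma>' v})"

text \<open>The induction takes two inputs at a time: a full adder sums \<open>x\<close>,
  \<open>y\<close> and the current sum bit \<open>p\<close> into a new sum bit \<open>q\<close> and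
  a carry \<open>c\<close>. Each pair of inputs thus costs seven clauses, two variables and one
  carry; a single leftover input is copied to the sum bit by one clause. \<open>V\<close> collects
  names to be avoided.\<close>

lemma half_sum_encoding:
  fixes bs :: "nat list"
  assumes "finite V" "set bs \<subseteq> V" "distinct bs"
  shows "\<exists>\<phi> Y C p. encodes_half_sum \<phi> (set bs) Y C p \<and> Y \<inter> V = {} \<and>
    2 * card C \<le> length bs \<and> 2 * card \<phi> \<le> 7 * length bs \<and> card Y \<le> length bs + 1"
  using assms
proof (induction bs rule: induct_list012)
  case 1
  obtain p where p: "p \<notin> V"
    using ex_new_if_finite[OF infinite_UNIV_nat \<open>finite V\<close>] by blast
  have "\<exists>\<sigma>'. (\<forall>v. v \<noteq> p \<longrightarrow> \<sigma>' v = \<sigma> v) \<and> \<not> \<sigma>' p" for \<sigma> :: "nat \<Rightarrow> bool"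
    by (rule exI[of _ "\<sigma>(p := False)"]) simp
  then have "encodes_half_sum {} (set []) {p} {} p"
    by (simp add: encodes_half_sum_def)
  moreover have "{p} \<inter> V = {}" "2 * card ({} :: nat set) \<le> length ([] :: nat list)"
    "2 * card ({} :: nat cnf) \<le> 7 * length ([] :: nat list)" "card {p} \<le> length ([] :: nat list) + 1"
    using p by auto
  ultimately show ?case
    by (intro exI[of _ "{}"] exI[of _ "{p}"] exI[of _ p] conjI)
next
  case (2 x)
  obtain p where p: "p \<notin> V"
    using ex_new_if_finite[OF infinite_UNIV_nat \<open>finite V\<close>] by blast
  have card: "card {v. v = x \<and> \<sigma> v} = of_bool (\<sigma> x)" for \<sigma> :: "nat \<Rightarrow> bool"
  proof -
    have "{v. v = x \<and> \<sigma> v} = (if \<sigma> x then {x} else {})"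
      by auto
    then show ?thesis
      by simp
  qed
  have "x \<noteq> p"
    using p 2 by auto
  have "encodes_half_sum {{Neg x, Pos p}} (set [x]) {p} {} p"
    unfolding encodes_half_sum_def
  proof (intro conjI allI impI)
    fix \<sigma> assume "models \<sigma> {{Neg x, Pos p}}"
    then show "card {v \<in> set [x]. \<sigma> v} \<le> of_bool (\<sigma> p) + 2 * card {v \<in> {}. \<sigma> v}"
      by (auto simp: card)
  next
    fix \<sigma> :: "nat \<Rightarrow> bool"
    show "\<exists>\<sigma>'. (\<forall>v. v \<notin> {p} \<longrightarrow> \<sigma>' v = \<sigma> v) \<and> models \<sigma>' {{Neg x, Pos p}} \<and>
        card {v \<in> set [x]. \<sigma> v} = of_bool (\<sigma>' p) + 2 * card {v \<in> {}. \<sigma>' v}"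
      using \<open>x \<noteq> p\<close> by (intro exI[of _ "\<sigma>(p := \<sigma> x)"]) (simp add: card)
  qed simp_all
  moreover have "{p} \<inter> V = {}" "2 * card ({} :: nat set) \<le> length [x]"
    "2 * card {{Neg x, Pos p}} \<le> 7 * length [x]" "card {p} \<le> length [x] + 1"
    using p by auto
  ultimately show ?case
    by (intro exI[of _ "{{Neg x, Pos p}}"] exI[of _ "{p}"] exI[of _ "{}"] exI[of _ p] conjI)
next
  case (3 x y bs)
  then obtain \<phi> Y C p where hs: "encodes_half_sum \<phi> (set bs) Y C p" and "Y \<inter> V = {}"
    and bounds: "2 * card C \<le> length bs" "2 * card \<phi> \<le> 7 * length bs" "card Y \<le> length bs + 1"
    by auto
  then have IH: "is_cnf \<phi>" "finite Y" "Y \<inter> V = {}" "C \<subseteq> Y" "p \<in> Y" "p \<notin> C"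
    "cnf_vars \<phi> \<subseteq> set bs \<union> Y"
    and sound: "\<And>\<sigma>. models \<sigma> \<phi> \<Longrightarrow>
      card {v \<in> set bs. \<sigma> v} \<le> of_bool (\<sigma> p) + 2 * card {v \<in> C. \<sigma> v}"
    and complete: "\<And>\<sigma>. \<exists>\<sigma>'. (\<forall>v. v \<notin> Y \<longrightarrow> \<sigma>' v = \<sigma> v) \<and> models \<sigma>' \<phi> \<and>
       card {v \<in> set bs. \<sigma> v} = of_bool (\<sigma>' p) + 2 * card {v \<in> C. \<sigma>' v}"
    by (simp_all add: encodes_half_sum_def)
  have fin: "finite (V \<union> Y)"
    using 3 IH by simp
  obtain q where q: "q \<notin> V \<union> Y"
    using ex_new_if_finite[OF infinite_UNIV_nat fin] by blast
  obtain c where c: "c \<notin> insert q (V \<union> Y)"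
    using ex_new_if_finite[OF infinite_UNIV_nat, of "insert q (V \<union> Y)"] fin by blast
  \<comment> \<open>One true input forces \<open>q\<close> or \<open>c\<close>, two force
    \<open>c\<close>, and three force \<open>q\<close> as well. So the value
    \<open>q + 2 * c\<close> is at least the sum of the inputs, but it may be too large.\<close>
  define \<psi> where "\<psi> = set [{Neg x, Pos q, Pos c}, {Neg y, Pos q, Pos c}, {Neg p, Pos q, Pos c},
    {Neg x, Neg y, Pos c}, {Neg x, Neg p, Pos c}, {Neg y, Neg p, Pos c},
    {Neg x, Neg y, Neg p, Pos q}]"
  have finC: "finite C"
    using IH finite_subset by blast
  have "c \<notin> C"
    using c IH by auto
  have ne: "x \<noteq> y" "x \<notin> set bs" "y \<notin> set bs" "x \<in> V" "y \<in> V" "set bs \<subseteq> V"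
    using 3 by auto
  have ne': "x \<noteq> q" "y \<noteq> q" "x \<noteq> c" "y \<noteq> c" "p \<noteq> q" "p \<noteq> c" "q \<noteq> c" "x \<notin> Y" "y \<notin> Y"
    using c q ne IH by auto
  have card_xy: "card {v \<in> set (x # y # bs). \<sigma> v} =
      of_bool (\<sigma> x) + of_bool (\<sigma> y) + card {v \<in> set bs. \<sigma> v}" for \<sigma>
  proof -
    have "{v \<in> set (x # y # bs). \<sigma> v} = (if \<sigma> x then {x} else {}) \<union>
       ((if \<sigma> y then {y} else {}) \<union> {v \<in> set bs. \<sigma> v})"
      by auto
    then show ?thesis
      using ne by simp
  qed
  have card_c: "card {v \<in> insert c C. \<sigma> v} = of_bool (\<sigma> c) + card {v \<in> C. \<sigma> v}" for \<sigma>
  proof -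
    have "{v \<in> insert c C. \<sigma> v} = (if \<sigma> c then {c} else {}) \<union> {v \<in> C. \<sigma> v}"
      by auto
    then show ?thesis
      using \<open>c \<notin> C\<close> finC by simp
  qed
  have "card \<psi> \<le> 7"
    unfolding \<psi>_def by (rule order_trans[OF card_length]) simp
  then have "card (\<phi> \<union> \<psi>) \<le> card \<phi> + 7"
    using card_Un_le[of \<phi> \<psi>] by linarith
  moreover have "card ({q, c} \<union> Y) \<le> card Y + 2"
    using card_Un_le[of "{q,c}" Y] ne' by simp
  moreover have "card (insert c C) \<le> card C + 1"
    using finC by (simp add: card_insert_if)
  moreover have "({q, c} \<union> Y) \<inter> V = {}"
    using IH q c by auto
  moreover have "encodes_half_sum (\<phi> \<union> \<psi>) (set (x # y # bs)) ({q, c} \<union> Y) (insert c C) q"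
    unfolding encodes_half_sum_def
  proof (intro conjI allI impI)
    show "is_cnf (\<phi> \<union> \<psi>)"
      using IH by (simp add: \<psi>_def)
    show "cnf_vars (\<phi> \<union> \<psi>) \<subseteq> set (x # y # bs) \<union> ({q, c} \<union> Y)"
      using IH by (auto simp: \<psi>_def)
    show "finite ({q, c} \<union> Y)" "insert c C \<subseteq> {q, c} \<union> Y" "q \<in> {q, c} \<union> Y" "q \<notin> insert c C"
      using IH q c by auto
  next
    fix \<sigma> assume "models \<sigma> (\<phi> \<union> \<psi>)"
    then have "models \<sigma> \<phi>" "models \<sigma> \<psi>"
      by auto
    then have "card {v \<in> set bs. \<sigma> v} \<le> of_bool (\<sigma> p) + 2 * card {v \<in> C. \<sigma> v}"
      "of_bool (\<sigma> x) + of_bool (\<sigma> y) + of_bool (\<sigma> p) \<le> of_bool (\<sigma> q) + 2 * (of_bool (\<sigma> c) :: nat)"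
      using sound by (auto simp: \<psi>_def of_bool_def)
    then show "card {v \<in> set (x # y # bs). \<sigma> v} \<le>
        of_bool (\<sigma> q) + 2 * card {v \<in> insert c C. \<sigma> v}"
      unfolding card_xy card_c by simp
  next
    fix \<sigma>
    obtain \<sigma>1 where \<sigma>1: "\<And>v. v \<notin> Y \<Longrightarrow> \<sigma>1 v = \<sigma> v" "models \<sigma>1 \<phi>"
      "card {v \<in> set bs. \<sigma> v} = of_bool (\<sigma>1 p) + 2 * card {v \<in> C. \<sigma>1 v}"
      using complete[of \<sigma>] by blast
    \<comment> \<open>Parity and majority are the exact adder outputs; they satisfy the one-sided
      clauses and give the equality that completeness requires.\<close>
    define \<sigma>2 where "\<sigma>2 = \<sigma>1(q := odd (of_bool (\<sigma> x) + of_bool (\<sigma> y) + of_bool (\<sigma>1 p) :: nat),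
      c := of_bool (\<sigma> x) + of_bool (\<sigma> y) + of_bool (\<sigma>1 p) \<ge> (2 :: nat))"
    have "models \<sigma>2 \<phi> \<longleftrightarrow> models \<sigma>1 \<phi>"
    proof (rule models_cong)
      fix v assume "v \<in> cnf_vars \<phi>"
      then have "v \<noteq> q" "v \<noteq> c"
        using IH ne q c by auto
      then show "\<sigma>2 v = \<sigma>1 v"
        by (simp add: \<sigma>2_def)
    qed
    then have "models \<sigma>2 \<phi>"
      using \<sigma>1 by simp
    moreover have val: "\<sigma>2 x = \<sigma> x" "\<sigma>2 y = \<sigma> y" "\<sigma>2 p = \<sigma>1 p"
      using ne' \<sigma>1(1) by (auto simp: \<sigma>2_def)
    moreover have "models \<sigma>2 \<psi>"
      unfolding \<psi>_def using ne' by (simp add: val) (auto simp: \<sigma>2_def of_bool_def)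
    moreover have "\<sigma>2 v = \<sigma> v" if "v \<notin> {q, c} \<union> Y" for v
      using that \<sigma>1(1) by (simp add: \<sigma>2_def)
    moreover have "{v \<in> C. \<sigma>2 v} = {v \<in> C. \<sigma>1 v}"
      using IH q c by (auto simp: \<sigma>2_def)
    moreover have "of_bool (\<sigma> x) + of_bool (\<sigma> y) + of_bool (\<sigma>1 p) =
        of_bool (\<sigma>2 q) + 2 * (of_bool (\<sigma>2 c) :: nat)"
      using ne' by (auto simp: \<sigma>2_def of_bool_def)
    ultimately show "\<exists>\<sigma>'. (\<forall>v. v \<notin> {q, c} \<union> Y \<longrightarrow> \<sigma>' v = \<sigma> v) \<and> models \<sigma>' (\<phi> \<union> \<psi>) \<and>
      card {v \<in> set (x # y # bs). \<sigma> v} = of_bool (\<sigma>' q) + 2 * card {v \<in> insert c C. \<sigma>' v}"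
      unfolding card_xy card_c using \<sigma>1(3) by (intro exI[of _ \<sigma>2]) auto
  qed
  moreover have "length (x # y # bs) = length bs + 2"
    by simp
  ultimately show ?case
    using bounds
    by (intro exI[of _ "\<phi> \<union> \<psi>"] exI[of _ "{q, c} \<union> Y"] exI[of _ "insert c C"] exI[of _ q]
      conjI) linarith+
qed

text \<open>After one adder chain only about half as many bits remain, to be bounded by
  \<open>k div 2\<close>, so the sizes add up geometrically. The set passed to the recursion has at
  most \<open>card X / 2 + 1\<close> elements; the extra element is paid for by the terms in
  \<open>k\<close>, since \<open>k div 2 + 1 \<le> k\<close> for positive \<open>k\<close>.\<close>

lemma at_most_encoding_by_halving:
  fixes X V :: "nat set"
  assumes "finite V" "X \<subseteq> V"
  shows "\<exists>\<phi> Y. encodes_at_most \<phi> X Y k \<and> Y \<inter> V = {} \<and>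
    card \<phi> \<le> 7 * card X + 7 * k \<and> card Y \<le> 2 * card X + 3 * k"
  using assms
proof (induction k arbitrary: X V rule: less_induct)
  case (less k)
  have finX: "finite X"
    using less.prems finite_subset by blast
  show ?case
  proof (cases "k = 0")
    case True
    define \<phi> where "\<phi> = (\<lambda>v. {Neg v}) ` X"
    have m: "models \<sigma> \<phi> \<longleftrightarrow> card {v \<in> X. \<sigma> v} \<le> 0" for \<sigma>
      using finX by (auto simp: \<phi>_def models_image)
    have "encodes_at_most \<phi> X {} k"
      unfolding encodes_at_most_def True
    proof (intro conjI allI impI)
      fix \<sigma> assume "card {v \<in> X. \<sigma> v} \<le> 0"
      then show "\<exists>\<sigma>'. (\<forall>v. v \<notin> {} \<longrightarrow> \<sigma>' v = \<sigma> v) \<and> models \<sigma>' \<phi>"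
        unfolding m[symmetric] by blast
    qed (use finX m in \<open>auto simp: \<phi>_def is_cnf_def cnf_vars_def\<close>)
    moreover have "card \<phi> \<le> card X"
      unfolding \<phi>_def by (rule card_image_le[OF finX])
    ultimately show ?thesis
      by (intro exI[of _ \<phi>] exI[of _ "{}"]) auto
  next
    case False
    obtain bs where bs: "set bs = X" "distinct bs"
      using finite_distinct_list[OF finX] by blast
    then have len: "length bs = card X"
      by (metis distinct_card)
    obtain \<phi> Y C p where hs: "encodes_half_sum \<phi> X Y C p" and "Y \<inter> V = {}"
      and bounds: "2 * card C \<le> card X" "2 * card \<phi> \<le> 7 * card X" "card Y \<le> card X + 1"
      using half_sum_encoding[OF less.prems(1) _ bs(2)] less.prems(2) unfolding bs(1) len by blast
    then have ch: "is_cnf \<phi>" "finite Y" "Y \<inter> V = {}" "C \<subseteq> Y" "p \<in> Y" "p \<notin> C"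
      "cnf_vars \<phi> \<subseteq> X \<union> Y"
      and sound: "\<And>\<sigma>. models \<sigma> \<phi> \<Longrightarrow>
        card {v \<in> X. \<sigma> v} \<le> of_bool (\<sigma> p) + 2 * card {v \<in> C. \<sigma> v}"
      and complete: "\<And>\<sigma>. \<exists>\<sigma>'. (\<forall>v. v \<notin> Y \<longrightarrow> \<sigma>' v = \<sigma> v) \<and> models \<sigma>' \<phi> \<and>
         card {v \<in> X. \<sigma> v} = of_bool (\<sigma>' p) + 2 * card {v \<in> C. \<sigma>' v}"
      by (simp_all add: encodes_half_sum_def)
    have finC: "finite C"
      using ch finite_subset by blast
    define h where "h = k div 2"
    have "h + 1 \<le> k"
      using False unfolding h_def by presburger
    \<comment> \<open>Let \<open>h = k div 2\<close>. For odd \<open>k\<close>,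
      \<open>p + 2 * c \<le> k\<close> holds iff \<open>c \<le> h\<close>, whatever the bit
      \<open>p\<close> is. For even \<open>k\<close> it holds iff \<open>p + c \<le> h\<close>, so
      \<open>p\<close> joins the carries.\<close>
    define D where "D = (if odd k then C else insert p C)"
    have "D \<subseteq> V \<union> Y" "D \<subseteq> Y"
      using ch by (auto simp: D_def)
    have cardD: "card D \<le> card C + 1"
      using finC by (simp add: D_def card_insert_if)
    have countD: "card {v \<in> D. \<sigma> v} = (if odd k then 0 else of_bool (\<sigma> p)) + card {v \<in> C. \<sigma> v}" for \<sigma>
    proof -
      have "{v \<in> D. \<sigma> v} = (if even k \<and> \<sigma> p then {p} else {}) \<union> {v \<in> C. \<sigma> v}"
        by (auto simp: D_def)
      then show ?thesis
        using \<open>p \<notin> C\<close> finC by simp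
    qed
    \<comment> \<open>The recursive call avoids \<open>Y\<close> as well as \<open>V\<close>, so
      changing variables of \<open>Z\<close> cannot disturb a model of
      \<open>\<phi>\<close>.\<close>
    obtain \<psi> Z where \<psi>: "encodes_at_most \<psi> D Z (k div 2)" "Z \<inter> (V \<union> Y) = {}"
      "card \<psi> \<le> 7 * card D + 7 * h" "card Z \<le> 2 * card D + 3 * h"
      unfolding h_def using less.IH[of "k div 2" "V \<union> Y" D] False less.prems ch \<open>D \<subseteq> V \<union> Y\<close> by auto
    have "card {v \<in> X. \<sigma> v} \<le> k" if "models \<sigma> (\<phi> \<union> \<psi>)" for \<sigma>
    proof -
      have "card {v \<in> X. \<sigma> v} \<le> of_bool (\<sigma> p) + 2 * card {v \<in> C. \<sigma> v}"
        using that sound by simp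
      moreover have "card {v \<in> D. \<sigma> v} \<le> k div 2"
        using that \<psi>(1) by (simp add: encodes_at_most_def)
      ultimately show ?thesis
        unfolding countD by (cases "\<sigma> p"; cases "odd k"; simp; presburger)
    qed
    moreover have "\<exists>\<sigma>'. (\<forall>v. v \<notin> Y \<union> Z \<longrightarrow> \<sigma>' v = \<sigma> v) \<and> models \<sigma>' (\<phi> \<union> \<psi>)"
      if le: "card {v \<in> X. \<sigma> v} \<le> k" for \<sigma>
    proof -
      obtain \<sigma>1 where \<sigma>1: "\<And>v. v \<notin> Y \<Longrightarrow> \<sigma>1 v = \<sigma> v" "models \<sigma>1 \<phi>"
        "card {v \<in> X. \<sigma> v} = of_bool (\<sigma>1 p) + 2 * card {v \<in> C. \<sigma>1 v}"
        using complete[of \<sigma>] by blast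
      have "card {v \<in> D. \<sigma>1 v} \<le> k div 2"
        using le unfolding countD \<sigma>1(3) by (cases "\<sigma>1 p"; cases "odd k"; simp; presburger)
      then obtain \<sigma>2 where \<sigma>2: "\<And>v. v \<notin> Z \<Longrightarrow> \<sigma>2 v = \<sigma>1 v" "models \<sigma>2 \<psi>"
        using encodes_at_most_extend[OF \<psi>(1), of \<sigma>1] by blast
      have "models \<sigma>2 \<phi> \<longleftrightarrow> models \<sigma>1 \<phi>"
        using \<psi>(2) less.prems ch(7) by (intro models_cong \<sigma>2(1)) auto
      then show ?thesis
        using \<sigma>1 \<sigma>2 by (intro exI[of _ \<sigma>2]) auto
    qed
    moreover have "is_cnf (\<phi> \<union> \<psi>)" "finite (Y \<union> Z)" "cnf_vars (\<phi> \<union> \<psi>) \<subseteq> X \<union> (Y \<union> Z)"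
      using ch \<psi>(1) \<open>D \<subseteq> Y\<close> by (auto simp: encodes_at_most_def)
    moreover have disj: "(Y \<union> Z) \<inter> V = {}" "X \<inter> (Y \<union> Z) = {}"
      using ch \<psi>(2) less.prems by auto
    ultimately have "encodes_at_most (\<phi> \<union> \<psi>) X (Y \<union> Z) k"
      unfolding encodes_at_most_def by (intro conjI allI impI)
    moreover have "card (\<phi> \<union> \<psi>) \<le> 7 * card X + 7 * k"
    proof -
      have "2 * card (\<phi> \<union> \<psi>) \<le> 7 * card X + 14 * card D + 14 * h"
        using card_Un_le[of \<phi> \<psi>] \<psi>(3) bounds(2) by linarith
      also have "\<dots> \<le> 14 * card X + 14 + 14 * h"
        using cardD bounds(1) by linarith
      also have "\<dots> \<le> 14 * card X + 14 * k"
        using \<open>h + 1 \<le> k\<close> by linarith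
      finally show ?thesis
        by simp
    qed
    moreover have "card (Y \<union> Z) \<le> 2 * card X + 3 * k"
    proof -
      have "card (Y \<union> Z) \<le> card X + 1 + (2 * card D + 3 * h)"
        using card_Un_le[of Y Z] \<psi>(4) bounds(3) by linarith
      also have "\<dots> \<le> 2 * card X + 3 + 3 * h"
        using cardD bounds(1) by linarith
      also have "\<dots> \<le> 2 * card X + 3 * k"
        using \<open>h + 1 \<le> k\<close> by linarith
      finally show ?thesis .
    qed
    ultimately show ?thesis
      using disj(1) by (intro exI conjI)
  qed
qed

text \<open>For \<open>k < card X\<close> the terms in \<open>k\<close> of the halving bound are
  absorbed by \<open>card X\<close>; for larger \<open>k\<close> the constraint is vacuous and the
  empty formula encodes it.\<close>

lemma linear_at_most_encoding:
  fixes X V :: "nat set"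
  assumes "finite V" "X \<subseteq> V"
  shows "\<exists>\<phi> Y. encodes_at_most \<phi> X Y k \<and> Y \<inter> V = {} \<and> card \<phi> \<le> 14 * card X \<and> card Y \<le> 5 * card X"
proof (cases "k < card X")
  case True
  show ?thesis
  proof -
    obtain \<phi> Y where "encodes_at_most \<phi> X Y k" "Y \<inter> V = {}"
      "card \<phi> \<le> 7 * card X + 7 * k" "card Y \<le> 2 * card X + 3 * k"
      using at_most_encoding_by_halving[OF assms, of k] by blast
    with True show ?thesis
      by (intro exI[of _ \<phi>] exI[of _ Y]) simp
  qed
next
  case False
  have "finite X"
    using assms finite_subset by blast
  then have "card {v \<in> X. \<sigma> v} \<le> k" for \<sigma>
    using False card_mono[of X "{v \<in> X. \<sigma> v}"] by fastforce
  then have "encodes_at_most {} X {} k"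
    unfolding encodes_at_most_def by (intro conjI allI impI exI) simp_all
  then show ?thesis
    by (intro exI[of _ "{}"]) auto
qed

section \<open>The grid construction\<close>

definition grid :: "nat \<Rightarrow> nat \<Rightarrow> (nat \<Rightarrow> nat) set" where
  "grid k m = {..k} \<rightarrow>\<^sub>E {..<m}"

text \<open>An axis-parallel line is represented by its point on the hyperplane orthogonal to it.\<close>

definition lines :: "nat \<Rightarrow> nat \<Rightarrow> nat \<Rightarrow> (nat \<Rightarrow> nat) set" where
  "lines k m d = (\<lambda>e. e(d := 0)) ` grid k m"

lemma finite_grid [simp]: "finite (grid k m)"
  by (simp add: grid_def finite_PiE)

lemma card_grid: "card (grid k m) = m ^ Suc k"
  by (simp add: grid_def card_PiE)

lemma finite_lines [simp]: "finite (lines k m d)"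
  by (simp add: lines_def)

lemma grid_lt: "e \<in> grid k m \<Longrightarrow> d \<le> k \<Longrightarrow> e d < m"
  by (auto simp: grid_def PiE_def)

lemma grid_upd: "e \<in> grid k m \<Longrightarrow> d \<le> k \<Longrightarrow> j < m \<Longrightarrow> e(d := j) \<in> grid k m"
  by (auto simp: grid_def PiE_def extensional_def)

lemma lines_iff: "d \<le> k \<Longrightarrow> q \<in> lines k m d \<longleftrightarrow> q \<in> grid k m \<and> q d = 0"
proof
  assume "d \<le> k" "q \<in> lines k m d"
  then obtain e where e: "e \<in> grid k m" "q = e(d := 0)"
    by (auto simp: lines_def)
  then have "0 < m"
    using grid_lt[OF e(1) \<open>d \<le> k\<close>] by simp
  then show "q \<in> grid k m \<and> q d = 0"
    using e grid_upd[OF e(1) \<open>d \<le> k\<close>] by simp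
next
  assume q: "q \<in> grid k m \<and> q d = 0"
  then have "q = q(d := 0)"
    by auto
  then show "q \<in> lines k m d"
    using q unfolding lines_def by blast
qed

lemma card_lines:
  assumes "d \<le> k"
  shows "card (lines k m d) \<le> m ^ k"
proof -
  let ?B = "\<lambda>i. if i = d then {0} else {..<m}"
  have "lines k m d \<subseteq> PiE {..k} ?B"
    using assms by (auto simp: lines_iff grid_def PiE_def)
  moreover have "finite (PiE {..k} ?B)"
    by (intro finite_PiE) auto
  ultimately have "card (lines k m d) \<le> card (PiE {..k} ?B)"
    by (rule card_mono[rotated])
  also have "\<dots> = (\<Prod>i\<le>k. card (?B i))"
    by (simp add: card_PiE)
  also have "\<dots> = card (?B d) * (\<Prod>i\<in>{..k} - {d}. card (?B i))"
    using assms by (intro prod.remove) auto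
  also have "(\<Prod>i\<in>{..k} - {d}. card (?B i)) = (\<Prod>i\<in>{..k} - {d}. m)"
    by (intro prod.cong) auto
  also have "\<dots> = m ^ k"
    using assms by simp
  finally show ?thesis
    by simp
qed

section \<open>Grid certificates: soundness and completeness\<close>

text \<open>Pigeonhole: if every direction failed, each \<open>d\<close> would have a witness in
  \<open>S - {s}\<close> that differs from \<open>s\<close> in coordinate \<open>d\<close> and
  otherwise at most in coordinate 0. Such witnesses are distinct for distinct \<open>d\<close>,
  which gives \<open>k\<close> elements in a set of fewer than \<open>k\<close>.\<close>

lemma separating_direction:
  fixes S :: "(nat \<Rightarrow> nat) set"
  assumes "finite S" "card S \<le> k" "s \<in> S"
  shows "\<exists>d\<in>{1..k}. \<forall>s'\<in>S. s'(0 := 0, d := 0) = s(0 := 0, d := 0) \<longrightarrow> s' d = s d"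
proof (rule ccontr)
  assume "\<not> ?thesis"
  then have "\<forall>d\<in>{1..k}. \<exists>s'. s' \<in> S \<and> s'(0 := 0, d := 0) = s(0 := 0, d := 0) \<and> s' d \<noteq> s d"
    by blast
  then obtain w where w: "\<And>d. d \<in> {1..k} \<Longrightarrow>
      w d \<in> S \<and> (w d)(0 := 0, d := 0) = s(0 := 0, d := 0) \<and> w d d \<noteq> s d"
    by metis
  have "inj_on w {1..k}"
  proof (rule inj_onI, rule ccontr)
    fix d d' assume d: "d \<in> {1..k}" "d' \<in> {1..k}" "w d = w d'" "d \<noteq> d'"
    then have "((w d)(0 := 0, d' := 0)) d = (s(0 := 0, d' := 0)) d"
      using w[OF d(2)] by simp
    then show False
      using d w[OF d(1)] by simp
  qed
  moreover have "w ` {1..k} \<subseteq> S - {s}"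
    using w by fastforce
  ultimately have "card {1..k} \<le> card (S - {s})"
    using assms(1) by (metis card_inj_on_le finite_Diff)
  moreover have "card (S - {s}) < card S"
    using assms by (intro psubset_card_mono) auto
  ultimately show False
    using assms(2) by simp
qed

text \<open>\<open>A\<close> selects lines in direction 0 and \<open>B d\<close> lines in direction \<open>d\<close>. \<open>U d\<close> selects those lines
  of the hyperplane \<open>e 0 = 0\<close> on which \<open>A\<close> may select at most one point, and \<open>T d\<close> records whether
  \<open>A\<close> has selected a point so far along such a line.\<close>

definition grid_certificate ::
    "nat \<Rightarrow> nat \<Rightarrow> (nat \<Rightarrow> nat) set \<Rightarrow> ((nat \<Rightarrow> nat) \<Rightarrow> bool) \<Rightarrow> (nat \<Rightarrow> (nat \<Rightarrow> nat) \<Rightarrow> bool) \<Rightarrow>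
     (nat \<Rightarrow> (nat \<Rightarrow> nat) \<Rightarrow> bool) \<Rightarrow> (nat \<Rightarrow> (nat \<Rightarrow> nat) \<Rightarrow> bool) \<Rightarrow> bool" where
  "grid_certificate k m S A B U T \<longleftrightarrow>
     (\<forall>e\<in>S. A (e(0 := 0))) \<and>
     (\<forall>e\<in>S. \<exists>d\<in>{1..k}. B d (e(d := 0))) \<and>
     (\<forall>d\<in>{1..k}. \<forall>q\<in>lines k m d. B d q \<longrightarrow> U d (q(0 := 0))) \<and>
     (\<forall>d\<in>{1..k}. \<forall>q\<in>lines k m 0. A q \<longrightarrow> T d q) \<and>
     (\<forall>d\<in>{1..k}. \<forall>q\<in>lines k m 0. Suc (q d) < m \<longrightarrow> T d q \<longrightarrow> T d (q(d := Suc (q d)))) \<and>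
     (\<forall>d\<in>{1..k}. \<forall>q\<in>lines k m 0. Suc (q d) < m \<longrightarrow> T d q \<longrightarrow> A (q(d := Suc (q d))) \<longrightarrow>
        \<not> U d (q(d := 0)))"

text \<open>Two points of \<open>S\<close> on a selected line of direction \<open>d\<close> project
  along direction 0 to two points selected by \<open>A\<close> on a line marked by
  \<open>U d\<close>. The mark \<open>T d\<close> travels from the lower to just below the higher
  one, where the last condition of the certificate is violated.\<close>

lemma grid_certificate_unique:
  assumes cert: "grid_certificate k m S A B U T" and "S \<subseteq> grid k m"
    and e: "e \<in> S" "e' \<in> S" and d: "d \<in> {1..k}" "B d (e(d := 0))"
    and same: "e(d := 0) = e'(d := 0)"
  shows "\<not> e d < e' d"
proof
  assume less: "e d < e' d"
  define q where "q = e(0 := 0)"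
  have "d \<le> k" "d \<noteq> 0"
    using d by auto
  have eg: "e \<in> grid k m" "e' \<in> grid k m"
    using e assms(2) by auto
  have "0 < m"
    using grid_lt[OF eg(1), of 0] by simp
  have q: "q(d := j) \<in> lines k m 0" if "j < m" for j
    using that eg \<open>0 < m\<close> \<open>d \<le> k\<close> \<open>d \<noteq> 0\<close> by (simp add: lines_iff q_def grid_upd)
  have lt: "e d < m" "e' d < m"
    using eg \<open>d \<le> k\<close> grid_lt by auto
  have next_T: "T d (q(d := Suc (q d)))" if "q \<in> lines k m 0" "Suc (q d) < m" "T d q" for q
    using cert d(1) that by (simp add: grid_certificate_def)
  have last_T: "\<not> U d (q(d := 0))"
    if "q \<in> lines k m 0" "Suc (q d) < m" "T d q" "A (q(d := Suc (q d)))" for q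
    using cert d(1) that by (simp add: grid_certificate_def)
  \<comment> \<open>The two points differ at most in coordinate \<open>d\<close>, and
    \<open>d\<close> is not 0, so their projections also differ only there.\<close>
  have "e' = e(d := e' d)"
    using arg_cong[OF same, of "\<lambda>f. f(d := e' d)"] by simp
  then have "e'(0 := 0) = e(d := e' d, 0 := 0)"
    by simp
  also have "\<dots> = q(d := e' d)"
    unfolding q_def using \<open>d \<noteq> 0\<close> by (rule fun_upd_twist)
  finally have e'q: "e'(0 := 0) = q(d := e' d)" .
  have qd: "q(d := e d) = q" "q d = e d"
    using \<open>d \<noteq> 0\<close> by (auto simp: q_def)
  have "A q"
    using cert e(1) by (simp add: grid_certificate_def q_def)
  \<comment> \<open>\<open>A\<close> selects \<open>q\<close>, which sets \<open>T d\<close> at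
    coordinate \<open>e d\<close>; from there the mark is passed on one coordinate at a
    time.\<close>
  have T: "T d (q(d := j))" if "e d \<le> j" "j < m" for j
    using that
  proof (induction j rule: dec_induct)
    case base
    have "q \<in> lines k m 0"
      using q[OF lt(1)] qd by simp
    then show ?case
      using cert d(1) \<open>A q\<close> unfolding qd by (simp add: grid_certificate_def)
  next
    case (step j)
    have "T d (q(d := j))"
      by (rule step.IH) (use step.prems in simp)
    then have "T d (q(d := j, d := Suc ((q(d := j)) d)))"
      using q[of j] step.prems by (intro next_T) auto
    then show ?case
      by (simp only: fun_upd_upd fun_upd_same)
  qed
  \<comment> \<open>The conflict arises at the coordinate just before \<open>e' d\<close>:
    \<open>T d\<close> holds there because \<open>e d \<le> j\<close>, and \<open>A\<close> selects
    the next point.\<close>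
  obtain j where j: "e' d = Suc j"
    using less by (cases "e' d") auto
  have "T d (q(d := j))" "q(d := j) \<in> lines k m 0"
    using T[of j] q[of j] j less lt by auto
  moreover have "A (q(d := Suc j))"
    using cert e(2) unfolding j[symmetric] e'q[symmetric] by (simp add: grid_certificate_def)
  moreover have "U d (q(d := 0))"
  proof -
    have "e(d := 0) \<in> lines k m d"
      using eg by (simp add: lines_def)
    then have "U d (e(d := 0, 0 := 0))"
      using cert d by (simp add: grid_certificate_def)
    moreover have "e(d := 0, 0 := 0) = q(d := 0)"
      unfolding q_def using \<open>d \<noteq> 0\<close> by (rule fun_upd_twist)
    ultimately show ?thesis
      by simp
  qed
  ultimately show False
    using last_T[of "q(d := j)"] j lt by simp
qed

text \<open>Each point is sent to a selected line of direction \<open>\<delta> e\<close> through it.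
  By uniqueness no selected line receives two points, so there are at most as many points as
  selected lines.\<close>

lemma grid_certificate_sound:
  assumes cert: "grid_certificate k m S A B U T" and "S \<subseteq> grid k m"
    and "card {(d, q) \<in> Sigma {1..k} (lines k m). B d q} \<le> k"
  shows "card S \<le> k"
proof -
  have "\<forall>e\<in>S. \<exists>d\<in>{1..k}. B d (e(d := 0))"
    using cert by (simp add: grid_certificate_def)
  then obtain \<delta> where \<delta>: "\<And>e. e \<in> S \<Longrightarrow> \<delta> e \<in> {1..k} \<and> B (\<delta> e) (e(\<delta> e := 0))"
    by metis
  let ?h = "\<lambda>e. (\<delta> e, e(\<delta> e := 0))"
  have "inj_on ?h S"
  proof (rule inj_onI)
    fix e e' assume e: "e \<in> S" "e' \<in> S" and h: "?h e = ?h e'"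
    from h have eq: "\<delta> e' = \<delta> e" "e(\<delta> e := 0) = e'(\<delta> e := 0)"
      by auto
    have \<delta>e: "\<delta> e \<in> {1..k}" "B (\<delta> e) (e(\<delta> e := 0))" "B (\<delta> e) (e'(\<delta> e := 0))"
      using \<delta>[OF e(1)] \<delta>[OF e(2)] unfolding eq(1) by blast+
    have "\<not> e (\<delta> e) < e' (\<delta> e)"
      by (rule grid_certificate_unique[OF cert assms(2) e \<delta>e(1,2) eq(2)])
    moreover have "\<not> e' (\<delta> e) < e (\<delta> e)"
      by (rule grid_certificate_unique[OF cert assms(2) e(2,1) \<delta>e(1,3) eq(2)[symmetric]])
    ultimately have "e (\<delta> e) = e' (\<delta> e)"
      by simp
    show "e = e'"
    proof
      fix i show "e i = e' i"
        using fun_cong[OF eq(2), of i] \<open>e (\<delta> e) = e' (\<delta> e)\<close> by (cases "i = \<delta> e") auto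
    qed
  qed
  moreover have "?h ` S \<subseteq> {(d, q) \<in> Sigma {1..k} (lines k m). B d q}"
    using \<delta> assms(2) by (auto simp: lines_def)
  moreover have "finite {(d, q) \<in> Sigma {1..k} (lines k m). B d q}"
    by (rule finite_subset[of _ "Sigma {1..k} (lines k m)"]) auto
  ultimately have "card S \<le> card {(d, q) \<in> Sigma {1..k} (lines k m). B d q}"
    by (rule card_inj_on_le)
  then show ?thesis
    using assms(3) by linarith
qed

text \<open>Every relation is chosen as small as the conditions permit, with each point using a
  separating direction \<open>\<delta> s\<close>. The choice of direction matters only for the last
  condition; at most one line per point is selected in \<open>B\<close>.\<close>

lemma grid_certificate_complete:
  assumes "S \<subseteq> grid k m" "card S \<le> k"
  shows "\<exists>A B U T. grid_certificate k m S A B U T \<and>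
    card {(d, q) \<in> Sigma {1..k} (lines k m). B d q} \<le> k"
proof -
  have finS: "finite S"
    using finite_subset[OF assms(1)] by simp
  have "\<forall>s\<in>S. \<exists>d. d \<in> {1..k} \<and>
      (\<forall>s'\<in>S. s'(0 := 0, d := 0) = s(0 := 0, d := 0) \<longrightarrow> s' d = s d)"
    using separating_direction[OF finS assms(2)] unfolding Bex_def by blast
  from bchoice[OF this] obtain \<delta> where \<delta>: "\<And>s. s \<in> S \<Longrightarrow> \<delta> s \<in> {1..k}"
    and sep: "\<And>s s'. s \<in> S \<Longrightarrow> s' \<in> S \<Longrightarrow>
      s'(0 := 0, \<delta> s := 0) = s(0 := 0, \<delta> s := 0) \<Longrightarrow> s' (\<delta> s) = s (\<delta> s)"
    by blast
  define A where "A q \<longleftrightarrow> (\<exists>s\<in>S. q = s(0 := 0))" for q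
  define B where "B d q \<longleftrightarrow> (\<exists>s\<in>S. d = \<delta> s \<and> q = s(\<delta> s := 0))" for d q
  define U where "U d r \<longleftrightarrow> (\<exists>s\<in>S. d = \<delta> s \<and> r = s(0 := 0, d := 0))" for d r
  \<comment> \<open>\<open>T d\<close> is the running disjunction of \<open>A\<close> along
    direction \<open>d\<close>.\<close>
  define T where "T d q \<longleftrightarrow> (\<exists>q'. A q' \<and> q'(d := 0) = q(d := 0) \<and> q' d \<le> q d)"
    for d :: nat and q :: "nat \<Rightarrow> nat"
  have "grid_certificate k m S A B U T"
    unfolding grid_certificate_def
  proof (intro conjI ballI impI)
    fix e assume "e \<in> S"
    then show "A (e(0 := 0))" "\<exists>d\<in>{1..k}. B d (e(d := 0))"
      using \<delta> by (auto simp: A_def B_def)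
  next
    fix d q assume "d \<in> {1..k}" "B d q"
    then obtain s where "s \<in> S" "d = \<delta> s" "q = s(d := 0)"
      by (auto simp: B_def)
    moreover have "s(d := 0, 0 := 0) = s(0 := 0, d := 0)"
      using \<open>d \<in> {1..k}\<close> by (intro fun_upd_twist) simp
    ultimately show "U d (q(0 := 0))"
      by (auto simp: U_def)
  next
    fix d q assume "A q"
    then show "T d q"
      unfolding T_def by blast
  next
    fix d q assume "T d q"
    then obtain q' where "A q'" "q'(d := 0) = q(d := 0)" "q' d \<le> q d"
      by (auto simp: T_def)
    then show "T d (q(d := Suc (q d)))"
      unfolding T_def by (intro exI[of _ q']) simp
  next
    fix d q assume d: "d \<in> {1..k}" and T: "T d q" and A: "A (q(d := Suc (q d)))"
    show "\<not> U d (q(d := 0))"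
    proof
      assume "U d (q(d := 0))"
      then obtain s where s: "s \<in> S" "d = \<delta> s" "q(d := 0) = s(0 := 0, d := 0)"
        by (auto simp: U_def)
      obtain s1 where s1: "s1 \<in> S" "s1(0 := 0, d := 0) = q(d := 0)" "(s1(0 := 0)) d \<le> q d"
        using T by (auto simp: T_def A_def)
      obtain s2 where s2: "s2 \<in> S" "q(d := Suc (q d)) = s2(0 := 0)"
        using A by (auto simp: A_def)
      \<comment> \<open>Both \<open>s1\<close> and \<open>s2\<close> agree with \<open>s\<close>
        outside coordinates 0 and \<open>d\<close>, so separation gives them the same coordinate
        \<open>d\<close>. But that of \<open>s1\<close> is at most \<open>q d\<close> and that of
        \<open>s2\<close> is \<open>Suc (q d)\<close>.\<close>
      have "s2(0 := 0, d := 0) = q(d := 0)"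
        using arg_cong[OF s2(2), of "\<lambda>f. f(d := 0)"] by simp
      then have "s2 d = s d"
        using sep[OF s(1) s2(1)] s by simp
      moreover have "s1 d = s d"
        using sep[OF s(1) s1(1)] s s1(2) by simp
      moreover have "s2 d = Suc (q d)"
        using fun_cong[OF s2(2), of d] d by simp
      ultimately show False
        using s1(3) d by simp
    qed
  qed
  moreover have "card {(d, q) \<in> Sigma {1..k} (lines k m). B d q} \<le> k"
  proof -
    have "{(d, q) \<in> Sigma {1..k} (lines k m). B d q} \<subseteq> (\<lambda>s. (\<delta> s, s(\<delta> s := 0))) ` S"
      by (auto simp: B_def)
    then have "card {(d, q) \<in> Sigma {1..k} (lines k m). B d q} \<le> card S"
      using finS by (rule surj_card_le[rotated])
    then show ?thesis
      using assms(2) by linarith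
  qed
  ultimately show ?thesis
    by blast
qed

section \<open>The CNF of a grid certificate: clauses, variables and size\<close>

lemma fresh_names:
  fixes V :: "nat set"
  assumes "finite I" "finite V"
  shows "\<exists>g :: 'a \<Rightarrow> nat. inj_on g I \<and> g ` I \<inter> V = {}"
proof -
  obtain h :: "'a \<Rightarrow> nat" where h: "inj_on h I"
    using finite_imp_inj_to_nat_seg[OF assms(1)] by metis
  obtain b where b: "\<And>v. v \<in> V \<Longrightarrow> v < b"
    using assms(2) unfolding finite_nat_set_iff_bounded by blast
  have "h i + b \<notin> V" for i
    using b[of "h i + b"] by auto
  then show ?thesis
    using h by (intro exI[of _ "\<lambda>i. h i + b"]) (auto simp: inj_on_def)
qed

text \<open>The six clause families state the six conditions of \<open>grid_certificate\<close> in
  the same order. Only the first two range over the inputs, which is the source of the exact leading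
  term \<open>2 * card X\<close>.\<close>

definition grid_cnf ::
    "nat \<Rightarrow> nat \<Rightarrow> 'v set \<Rightarrow> ('v \<Rightarrow> nat \<Rightarrow> nat) \<Rightarrow> ((nat \<Rightarrow> nat) \<Rightarrow> 'v) \<Rightarrow> (nat \<Rightarrow> (nat \<Rightarrow> nat) \<Rightarrow> 'v) \<Rightarrow>
     (nat \<Rightarrow> (nat \<Rightarrow> nat) \<Rightarrow> 'v) \<Rightarrow> (nat \<Rightarrow> (nat \<Rightarrow> nat) \<Rightarrow> 'v) \<Rightarrow> 'v cnf" where
  "grid_cnf k m X f a b u t =
     (\<lambda>x. {Neg x, Pos (a ((f x)(0 := 0)))}) ` X \<union>
     (\<lambda>x. insert (Neg x) ((\<lambda>d. Pos (b d ((f x)(d := 0)))) ` {1..k})) ` X \<union>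
     (\<lambda>(d, q). {Neg (b d q), Pos (u d (q(0 := 0)))}) ` Sigma {1..k} (lines k m) \<union>
     (\<lambda>(d, q). {Neg (a q), Pos (t d q)}) ` ({1..k} \<times> lines k m 0) \<union>
     (\<lambda>(d, q). {Neg (t d q), Pos (t d (q(d := Suc (q d))))}) `
       {(d, q) \<in> {1..k} \<times> lines k m 0. Suc (q d) < m} \<union>
     (\<lambda>(d, q). {Neg (t d q), Neg (a (q(d := Suc (q d)))), Neg (u d (q(d := 0)))}) `
       {(d, q) \<in> {1..k} \<times> lines k m 0. Suc (q d) < m}"

lemma models_grid_cnf:
  "models \<sigma> (grid_cnf k m X f a b u t) \<longleftrightarrow>
    grid_certificate k m (f ` {x \<in> X. \<sigma> x}) (\<lambda>q. \<sigma> (a q)) (\<lambda>d q. \<sigma> (b d q))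
      (\<lambda>d q. \<sigma> (u d q)) (\<lambda>d q. \<sigma> (t d q))"
proof -
  have "models \<sigma> (grid_cnf k m X f a b u t) \<longleftrightarrow>
     (\<forall>x\<in>X. \<not> \<sigma> x \<or> \<sigma> (a ((f x)(0 := 0)))) \<and>
     (\<forall>x\<in>X. \<not> \<sigma> x \<or> (\<exists>d\<in>{1..k}. \<sigma> (b d ((f x)(d := 0))))) \<and>
     (\<forall>(d, q)\<in>Sigma {1..k} (lines k m). \<not> \<sigma> (b d q) \<or> \<sigma> (u d (q(0 := 0)))) \<and>
     (\<forall>(d, q)\<in>{1..k} \<times> lines k m 0. \<not> \<sigma> (a q) \<or> \<sigma> (t d q)) \<and>
     (\<forall>(d, q)\<in>{(d, q) \<in> {1..k} \<times> lines k m 0. Suc (q d) < m}.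
        \<not> \<sigma> (t d q) \<or> \<sigma> (t d (q(d := Suc (q d))))) \<and>
     (\<forall>(d, q)\<in>{(d, q) \<in> {1..k} \<times> lines k m 0. Suc (q d) < m}.
        \<not> \<sigma> (t d q) \<or> \<not> \<sigma> (a (q(d := Suc (q d)))) \<or> \<not> \<sigma> (u d (q(d := 0))))"
    unfolding grid_cnf_def models_Un models_image
    by (simp add: case_prod_unfold clause_satisfied_image del: fun_upd_apply)
  then show ?thesis
    unfolding grid_certificate_def
    by (elim ssubst) (intro arg_cong2[where f = "(\<and>)"]; auto simp del: fun_upd_apply)
qed

lemma card_Sigma_lines: "card (Sigma {1..k} (lines k m)) \<le> k * m ^ k"
proof -
  have "card (Sigma {1..k} (lines k m)) = (\<Sum>d\<in>{1..k}. card (lines k m d))"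
    by simp
  also have "\<dots> \<le> (\<Sum>d\<in>{1..k}. m ^ k)"
    by (intro sum_mono card_lines) simp
  finally show ?thesis
    by simp
qed

lemma card_Times_lines: "card ({1..k} \<times> lines k m 0) \<le> k * m ^ k"
  using card_lines[of 0 k m] by (simp add: card_cartesian_product)

lemma card_image_le_trans: "finite I \<Longrightarrow> card I \<le> K \<Longrightarrow> card (h ` I) \<le> K"
  using card_image_le order_trans by blast

lemma card_Un_le_add: "card P \<le> K \<Longrightarrow> card Q \<le> L \<Longrightarrow> card (P \<union> Q) \<le> K + L"
  using card_Un_le[of P Q] by linarith

lemma card_grid_cnf:
  assumes "finite X"
  shows "card (grid_cnf k m X f a b u t) \<le> 2 * card X + 4 * (k * m ^ k)"
proof -
  let ?W = "{(d, q) \<in> {1..k} \<times> lines k m 0. Suc (q d) < m}"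
  have W: "card ?W \<le> k * m ^ k" "finite ?W"
    by (rule order_trans[OF card_mono card_Times_lines] finite_subset[of _ "{1..k} \<times> lines k m 0"];
      force)+
  have "card (grid_cnf k m X f a b u t) \<le>
      card X + card X + k * m ^ k + k * m ^ k + k * m ^ k + k * m ^ k"
    unfolding grid_cnf_def
    using assms W by (intro card_Un_le_add card_image_le_trans card_Sigma_lines card_Times_lines) auto
  then show ?thesis
    by simp
qed

datatype aux = AuxA "nat \<Rightarrow> nat" | AuxB nat "nat \<Rightarrow> nat" | AuxU nat "nat \<Rightarrow> nat" | AuxT nat "nat \<Rightarrow> nat"

text \<open>These are the indices that the clauses can mention. A \<open>U\<close> index has
  coordinates 0 and \<open>d\<close> both set to 0; writing these indices as an image of
  \<open>{1..k} \<times> lines k m 0\<close> gives them the same crude bound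
  \<open>k * m ^ k\<close> as the others.\<close>

definition grid_aux :: "nat \<Rightarrow> nat \<Rightarrow> aux set" where
  "grid_aux k m = AuxA ` lines k m 0 \<union>
     (\<lambda>(d, q). AuxB d q) ` Sigma {1..k} (lines k m) \<union>
     (\<lambda>(d, q). AuxU d (q(d := 0))) ` ({1..k} \<times> lines k m 0) \<union>
     (\<lambda>(d, q). AuxT d q) ` ({1..k} \<times> lines k m 0)"

lemma finite_grid_aux [simp]: "finite (grid_aux k m)"
  by (simp add: grid_aux_def)

lemma card_grid_aux:
  assumes "1 \<le> k"
  shows "card (grid_aux k m) \<le> 4 * (k * m ^ k)"
proof -
  have "m ^ k \<le> k * m ^ k"
    using assms by simp
  then have "card (lines k m 0) \<le> k * m ^ k"
    using card_lines[of 0 k m] by linarith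
  then have "card (grid_aux k m) \<le> k * m ^ k + k * m ^ k + k * m ^ k + k * m ^ k"
    unfolding grid_aux_def
    by (intro card_Un_le_add card_image_le_trans card_Sigma_lines card_Times_lines) auto
  then show ?thesis
    by simp
qed

lemma grid_aux_mem:
  assumes "d \<in> {1..k}" "q \<in> lines k m 0"
  shows "AuxA q \<in> grid_aux k m" "AuxU d (q(d := 0)) \<in> grid_aux k m" "AuxT d q \<in> grid_aux k m"
    "Suc (q d) < m \<Longrightarrow> q(d := Suc (q d)) \<in> lines k m 0"
  using assms by (force simp: grid_aux_def lines_iff grid_upd)+

lemma grid_aux_mem_line:
  assumes "d \<in> {1..k}" "q \<in> lines k m d"
  shows "AuxB d q \<in> grid_aux k m" "AuxU d (q(0 := 0)) \<in> grid_aux k m"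
proof -
  show "AuxB d q \<in> grid_aux k m"
    using assms by (force simp: grid_aux_def)
  have q: "q \<in> grid k m" "q d = 0" "d \<noteq> 0"
    using assms by (auto simp: lines_iff)
  then have "q(0 := 0) \<in> lines k m 0"
    by (simp add: lines_def)
  moreover have "(q(0 := 0))(d := 0) = q(0 := 0)"
    using q by auto
  ultimately show "AuxU d (q(0 := 0)) \<in> grid_aux k m"
    using grid_aux_mem(2)[OF assms(1)] by metis
qed

lemma grid_aux_mem_point:
  assumes "e \<in> grid k m"
  shows "AuxA (e(0 := 0)) \<in> grid_aux k m" "d \<in> {1..k} \<Longrightarrow> AuxB d (e(d := 0)) \<in> grid_aux k m"
proof -
  show "AuxA (e(0 := 0)) \<in> grid_aux k m"
    using assms by (simp add: grid_aux_def lines_def)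
  show "AuxB d (e(d := 0)) \<in> grid_aux k m" if "d \<in> {1..k}"
    using assms that by (intro grid_aux_mem_line) (simp_all add: lines_def)
qed

lemma grid_aux_mem_next:
  assumes "d \<in> {1..k}" "q \<in> lines k m 0" "Suc (q d) < m"
  shows "AuxA (q(d := Suc (q d))) \<in> grid_aux k m" "AuxT d (q(d := Suc (q d))) \<in> grid_aux k m"
  using grid_aux_mem[OF assms(1) grid_aux_mem(4)[OF assms]] by auto

text \<open>A certificate inspects its relations only at indices in \<open>grid_aux k m\<close>.
  This permits a naming of the variables that is injective on that finite set alone.\<close>

lemma grid_certificate_cong:
  assumes eq: "\<And>i. i \<in> grid_aux k m \<Longrightarrow> val i \<longleftrightarrow> val' i" and "S \<subseteq> grid k m"
    and cert: "grid_certificate k m S (\<lambda>q. val (AuxA q)) (\<lambda>d q. val (AuxB d q))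
      (\<lambda>d q. val (AuxU d q)) (\<lambda>d q. val (AuxT d q))"
  shows "grid_certificate k m S (\<lambda>q. val' (AuxA q)) (\<lambda>d q. val' (AuxB d q))
      (\<lambda>d q. val' (AuxU d q)) (\<lambda>d q. val' (AuxT d q))"
  unfolding grid_certificate_def
proof (intro conjI ballI impI)
  fix e assume e: "e \<in> S"
  then have "e \<in> grid k m"
    using assms(2) by blast
  note mem = grid_aux_mem_point[OF this]
  show "val' (AuxA (e(0 := 0)))"
    using cert e eq[OF mem(1)] by (simp add: grid_certificate_def)
  obtain d where d: "d \<in> {1..k}" "val (AuxB d (e(d := 0)))"
    using cert e by (auto simp: grid_certificate_def)
  then show "\<exists>d\<in>{1..k}. val' (AuxB d (e(d := 0)))"
    using eq[OF mem(2)[OF d(1)]] by blast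
next
  fix d q assume d: "d \<in> {1..k}" "q \<in> lines k m d" "val' (AuxB d q)"
  note mem = grid_aux_mem_line[OF d(1,2)]
  show "val' (AuxU d (q(0 := 0)))"
    using cert d eq[OF mem(1)] eq[OF mem(2)] by (simp add: grid_certificate_def)
next
  fix d q assume d: "d \<in> {1..k}" "q \<in> lines k m 0" "val' (AuxA q)"
  note mem = grid_aux_mem[OF d(1,2)]
  show "val' (AuxT d q)"
    using cert d eq[OF mem(1)] eq[OF mem(3)] by (simp add: grid_certificate_def)
next
  fix d q assume d: "d \<in> {1..k}" "q \<in> lines k m 0" "Suc (q d) < m" and T: "val' (AuxT d q)"
  note mem = grid_aux_mem[OF d(1,2)] grid_aux_mem_next[OF d]
  show "val' (AuxT d (q(d := Suc (q d))))"
    using cert d T eq[OF mem(3)] eq[OF mem(6)] by (simp add: grid_certificate_def)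
  assume A: "val' (AuxA (q(d := Suc (q d))))"
  show "\<not> val' (AuxU d (q(d := 0)))"
    using cert d T A eq[OF mem(2)] eq[OF mem(3)] eq[OF mem(5)] by (simp add: grid_certificate_def)
qed

lemma cnf_vars_grid_cnf:
  assumes "f ` X \<subseteq> grid k m"
  shows "cnf_vars (grid_cnf k m X f (\<lambda>q. g (AuxA q)) (\<lambda>d q. g (AuxB d q)) (\<lambda>d q. g (AuxU d q))
    (\<lambda>d q. g (AuxT d q))) \<subseteq> X \<union> g ` grid_aux k m"
proof -
  have X: "f x \<in> grid k m" "(f x)(d := 0) \<in> lines k m d" if "x \<in> X" for x d
    using assms that by (auto simp: lines_def)
  show ?thesis
    unfolding grid_cnf_def cnf_vars_simps
    by (auto simp: cnf_vars_def simp del: fun_upd_apply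
      intro!: imageI X grid_aux_mem_point grid_aux_mem grid_aux_mem_next grid_aux_mem_line)
qed

text \<open>The grid clauses are joined with a linear-size encoding which says that at most
  \<open>k\<close> of the \<open>B\<close> variables are true. With at most \<open>k * m ^ k\<close>
  such variables, the constants are \<open>18 = 4 + 14\<close> for clauses and
  \<open>9 = 4 + 5\<close> for auxiliary variables.\<close>

lemma grid_encoding:
  fixes X :: "nat set"
  assumes "finite X" "card X \<le> m ^ Suc k" "1 \<le> k"
  shows "\<exists>\<phi> Y. encodes_at_most \<phi> X Y k \<and>
    card \<phi> \<le> 2 * card X + 18 * (k * m ^ k) \<and> card Y \<le> 9 * (k * m ^ k)"
proof -
  obtain f where f: "f ` X \<subseteq> grid k m" "inj_on f X"
    using card_le_inj[of X "grid k m"] assms(1,2) unfolding card_grid by auto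
  obtain g :: "aux \<Rightarrow> nat" where g: "inj_on g (grid_aux k m)" "g ` grid_aux k m \<inter> X = {}"
    using fresh_names[OF finite_grid_aux assms(1)] by blast
  let ?I = "grid_aux k m"
  let ?E = "Sigma {1..k} (lines k m)"
  define \<phi> where "\<phi> = grid_cnf k m X f (\<lambda>q. g (AuxA q)) (\<lambda>d q. g (AuxB d q)) (\<lambda>d q. g (AuxU d q))
    (\<lambda>d q. g (AuxT d q))"
  define bs where "bs = (\<lambda>(d, q). g (AuxB d q)) ` ?E"
  have bs_sub: "bs \<subseteq> g ` ?I"
    by (auto simp: bs_def grid_aux_mem_line)
  have inj_b: "inj_on (\<lambda>(d, q). g (AuxB d q)) ?E"
  proof (rule inj_onI)
    fix y z assume yz: "y \<in> ?E" "z \<in> ?E" "(\<lambda>(d, q). g (AuxB d q)) y = (\<lambda>(d, q). g (AuxB d q)) z"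
    obtain d q d' q' where "y = (d, q)" "z = (d', q')"
      by (cases y; cases z)
    with yz show "y = z"
      using inj_onD[OF g(1), of "AuxB d q" "AuxB d' q'"] by (auto simp: grid_aux_mem_line)
  qed
  have count_b: "card {v \<in> bs. \<sigma> v} = card {(d, q) \<in> ?E. \<sigma> (g (AuxB d q))}" for \<sigma>
  proof -
    have "{v \<in> bs. \<sigma> v} = (\<lambda>(d, q). g (AuxB d q)) ` {(d, q) \<in> ?E. \<sigma> (g (AuxB d q))}"
      by (auto simp: bs_def)
    moreover have "inj_on (\<lambda>(d, q). g (AuxB d q)) {(d, q) \<in> ?E. \<sigma> (g (AuxB d q))}"
      using inj_b by (rule inj_on_subset) auto
    ultimately show ?thesis
      by (simp add: card_image)
  qed
  have count_X: "card (f ` {x \<in> X. \<sigma> x}) = card {x \<in> X. \<sigma> x}" for \<sigma>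
    using f(2) by (intro card_image inj_on_subset[OF f(2)]) auto
  have card_bs: "card bs \<le> k * m ^ k"
    unfolding bs_def using card_image_le[of ?E "\<lambda>(d, q). g (AuxB d q)"] card_Sigma_lines[of k m]
    by (simp del: card_SigmaI)
  have "finite (X \<union> g ` ?I)" "bs \<subseteq> X \<union> g ` ?I"
    using assms(1) bs_sub by auto
  then obtain \<psi> Z where \<psi>: "encodes_at_most \<psi> bs Z k" "Z \<inter> (X \<union> g ` ?I) = {}"
    "card \<psi> \<le> 14 * card bs" "card Z \<le> 5 * card bs"
    using linear_at_most_encoding[of "X \<union> g ` ?I" bs k] by blast
  have \<phi>_vars: "cnf_vars \<phi> \<subseteq> X \<union> g ` ?I"
    unfolding \<phi>_def using f(1) by (rule cnf_vars_grid_cnf)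
  have "encodes_at_most (\<phi> \<union> \<psi>) X (g ` ?I \<union> Z) k"
    unfolding encodes_at_most_def
  proof (intro conjI allI impI)
    have "finite {(d, q) \<in> {1..k} \<times> lines k m 0. Suc (q d) < m}"
      by (rule finite_subset[of _ "{1..k} \<times> lines k m 0"]) auto
    then have "is_cnf \<phi>"
      using assms(1) unfolding \<phi>_def grid_cnf_def is_cnf_simps by (auto simp: is_cnf_def)
    then show "is_cnf (\<phi> \<union> \<psi>)"
      using \<psi>(1) by (simp add: encodes_at_most_def)
    show "finite (g ` ?I \<union> Z)"
      using \<psi>(1) by (simp add: encodes_at_most_def)
    show "X \<inter> (g ` ?I \<union> Z) = {}"
      using g(2) \<psi>(2) by auto
    have "cnf_vars \<psi> \<subseteq> bs \<union> Z"
      using \<psi>(1) by (simp add: encodes_at_most_def)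
    then show "cnf_vars (\<phi> \<union> \<psi>) \<subseteq> X \<union> (g ` ?I \<union> Z)"
      using \<phi>_vars bs_sub by auto
  next
    fix \<sigma> assume "models \<sigma> (\<phi> \<union> \<psi>)"
    then have m: "models \<sigma> \<phi>" "models \<sigma> \<psi>"
      by simp_all
    have "card {v \<in> bs. \<sigma> v} \<le> k"
      using \<psi>(1) m(2) by (simp add: encodes_at_most_def)
    then have "card (f ` {x \<in> X. \<sigma> x}) \<le> k"
      unfolding count_b
      by (rule grid_certificate_sound[OF m(1)[unfolded \<phi>_def models_grid_cnf], rotated])
        (use f(1) in auto)
    then show "card {x \<in> X. \<sigma> x} \<le> k"
      unfolding count_X .
  next
    fix \<sigma> assume "card {x \<in> X. \<sigma> x} \<le> k"
    then have card: "card (f ` {x \<in> X. \<sigma> x}) \<le> k"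
      unfolding count_X .
    have sub: "f ` {x \<in> X. \<sigma> x} \<subseteq> grid k m"
      using f(1) by auto
    from grid_certificate_complete[OF sub card]
    obtain A B U T where cert: "grid_certificate k m (f ` {x \<in> X. \<sigma> x}) A B U T"
      and B: "card {(d, q) \<in> ?E. B d q} \<le> k"
      by blast
    define val where "val i = (case i of AuxA q \<Rightarrow> A q | AuxB d q \<Rightarrow> B d q | AuxU d q \<Rightarrow> U d q
      | AuxT d q \<Rightarrow> T d q)" for i
    \<comment> \<open>Certificate values are read back through the inverse of \<open>g\<close> on
      its finite domain; all other variables, the inputs included, keep their values.\<close>
    define \<sigma>1 where "\<sigma>1 v = (if v \<in> g ` ?I then val (inv_into ?I g v) else \<sigma> v)" for v
    have \<sigma>1_g: "\<sigma>1 (g i) = val i" if "i \<in> ?I" for i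
      using that g(1) by (simp add: \<sigma>1_def)
    have \<sigma>1_X: "\<sigma>1 v = \<sigma> v" if "v \<notin> g ` ?I" for v
      using that by (simp add: \<sigma>1_def)
    have "{x \<in> X. \<sigma>1 x} = {x \<in> X. \<sigma> x}"
      using g(2) \<sigma>1_X by blast
    have "grid_certificate k m (f ` {x \<in> X. \<sigma> x}) (\<lambda>q. \<sigma>1 (g (AuxA q)))
       (\<lambda>d q. \<sigma>1 (g (AuxB d q))) (\<lambda>d q. \<sigma>1 (g (AuxU d q))) (\<lambda>d q. \<sigma>1 (g (AuxT d q)))"
    proof (rule grid_certificate_cong[OF _ sub])
      show "val i \<longleftrightarrow> \<sigma>1 (g i)" if "i \<in> ?I" for i
        using \<sigma>1_g[OF that] by simp
      show "grid_certificate k m (f ` {x \<in> X. \<sigma> x}) (\<lambda>q. val (AuxA q)) (\<lambda>d q. val (AuxB d q))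
          (\<lambda>d q. val (AuxU d q)) (\<lambda>d q. val (AuxT d q))"
        using cert by (simp add: val_def)
    qed
    then have "models \<sigma>1 \<phi>"
      unfolding \<phi>_def models_grid_cnf \<open>{x \<in> X. \<sigma>1 x} = {x \<in> X. \<sigma> x}\<close> .
    have "{(d, q) \<in> ?E. \<sigma>1 (g (AuxB d q))} = {(d, q) \<in> ?E. B d q}"
      by (auto simp: \<sigma>1_g grid_aux_mem_line val_def)
    then have "card {v \<in> bs. \<sigma>1 v} \<le> k"
      unfolding count_b using B by simp
    then obtain \<sigma>2 where \<sigma>2: "\<And>v. v \<notin> Z \<Longrightarrow> \<sigma>2 v = \<sigma>1 v" "models \<sigma>2 \<psi>"
      using encodes_at_most_extend[OF \<psi>(1), of \<sigma>1] by blast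
    have "models \<sigma>2 \<phi> \<longleftrightarrow> models \<sigma>1 \<phi>"
      using \<psi>(2) \<phi>_vars by (intro models_cong \<sigma>2(1)) auto
    then have "models \<sigma>2 (\<phi> \<union> \<psi>)"
      using \<open>models \<sigma>1 \<phi>\<close> \<sigma>2(2) by simp
    moreover have "\<forall>v. v \<notin> g ` ?I \<union> Z \<longrightarrow> \<sigma>2 v = \<sigma> v"
      using \<sigma>2(1) \<sigma>1_X by simp
    ultimately show "\<exists>\<sigma>'. (\<forall>v. v \<notin> g ` ?I \<union> Z \<longrightarrow> \<sigma>' v = \<sigma> v) \<and> models \<sigma>' (\<phi> \<union> \<psi>)"
      by blast
  qed
  moreover have "card (\<phi> \<union> \<psi>) \<le> 2 * card X + 18 * (k * m ^ k)"
  proof -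
    have "card \<phi> \<le> 2 * card X + 4 * (k * m ^ k)"
      unfolding \<phi>_def by (rule card_grid_cnf[OF assms(1)])
    then show ?thesis
      using card_Un_le[of \<phi> \<psi>] \<psi>(3) card_bs by linarith
  qed
  moreover have "card (g ` ?I \<union> Z) \<le> 9 * (k * m ^ k)"
    using card_Un_le[of "g ` ?I" Z] card_image_le[OF finite_grid_aux, of g k m]
      card_grid_aux[OF assms(3), of m] \<psi>(4) card_bs by linarith
  ultimately show ?thesis
    by (intro exI conjI)
qed

section \<open>Choice of the grid side and the final bounds\<close>

text \<open>Rounding up multiplies \<open>r\<close> by at most
  \<open>1 + 1 / r \<le> 1 + 1 / k \<le> exp (1 / k)\<close>, and the \<open>k\<close>-th power of
  the last factor is \<open>exp 1 \<le> 3\<close>.\<close>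

lemma ceiling_power_bound:
  fixes r :: real
  assumes "1 \<le> k" "real k \<le> r"
  shows "real (nat \<lceil>r\<rceil>) ^ k \<le> 3 * r ^ k"
proof -
  have k: "0 < real k" "0 < r"
    using assms by linarith+
  have "real (nat \<lceil>r\<rceil>) \<le> r + 1"
    using k by linarith
  also have "\<dots> \<le> r * (1 + 1 / real k)"
    using assms k by (simp add: field_simps)
  also have "\<dots> \<le> r * exp (1 / real k)"
    using k exp_ge_add_one_self[of "1 / real k"] by (intro mult_left_mono) auto
  finally have "real (nat \<lceil>r\<rceil>) ^ k \<le> (r * exp (1 / real k)) ^ k"
    by (intro power_mono) auto
  also have "\<dots> = r ^ k * exp 1"
    using k by (simp add: power_mult_distrib flip: exp_of_nat_mult)
  also have "\<dots> \<le> r ^ k * 3"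
    using exp_le k by (intro mult_left_mono) auto
  finally show ?thesis
    by (simp add: mult.commute)
qed

text \<open>The constant 54 is 18 from the grid encoding times 3 from rounding the side; it also
  dominates the constants 14 and 5 of the linear encoding.\<close>

lemma at_most_encoding:
  fixes X :: "nat set"
  assumes "finite X" "1 \<le> card X" "1 \<le> k"
  defines "N \<equiv> real (card X) powr (real k / (real k + 1))"
  shows "\<exists>\<phi> Y. encodes_at_most \<phi> X Y k \<and>
    real (card \<phi>) \<le> 2 * real (card X) + 54 * real k * N \<and> real (card Y) \<le> 54 * real k * N"
proof -
  define n where "n = card X"
  define r where "r = real n powr (1 / (real k + 1))"
  have n: "0 < real n" and r: "0 < r"
    using assms(2) by (auto simp: n_def r_def)
  have N: "N = r ^ k"
    using n by (simp add: N_def r_def n_def powr_powr flip: powr_realpow)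
  have rn: "r ^ Suc k = real n"
  proof -
    have "r ^ Suc k = r powr (real k + 1)"
      using r powr_realpow[of r "Suc k"] by (simp add: add.commute)
    also have "\<dots> = real n"
      using n by (simp add: r_def powr_powr)
    finally show ?thesis .
  qed
  have "0 \<le> N"
    using r by (simp add: N)
  show ?thesis
  proof (cases "real k \<le> r")
    case True
    define m where "m = nat \<lceil>r\<rceil>"
    have m: "real m ^ k \<le> 3 * N"
      unfolding m_def N by (rule ceiling_power_bound[OF assms(3) True])
    have "real n \<le> real m ^ Suc k"
      unfolding rn[symmetric] m_def using r by (intro power_mono) linarith+
    then have "card X \<le> m ^ Suc k"
      unfolding n_def by (metis of_nat_le_iff of_nat_power)
    then obtain \<phi> Y where \<phi>: "encodes_at_most \<phi> X Y k"
      "card \<phi> \<le> 2 * card X + 18 * (k * m ^ k)" "card Y \<le> 9 * (k * m ^ k)"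
      using grid_encoding[OF assms(1) _ assms(3)] by blast
    have "real (k * m ^ k) \<le> 3 * (real k * N)"
      using mult_left_mono[OF m, of "real k"] by (simp add: mult.left_commute)
    moreover have "real (card \<phi>) \<le> 2 * real (card X) + 18 * real (k * m ^ k)"
      using of_nat_mono[OF \<phi>(2), where 'a = real] by simp
    moreover have "real (card Y) \<le> 9 * real (k * m ^ k)"
      using of_nat_mono[OF \<phi>(3), where 'a = real] by simp
    moreover have "0 \<le> real k * N"
      using \<open>0 \<le> N\<close> by simp
    ultimately have "real (card \<phi>) \<le> 2 * real (card X) + 54 * (real k * N)"
      "real (card Y) \<le> 54 * (real k * N)"
      by linarith+
    then show ?thesis
      using \<phi>(1) by (intro exI conjI) (simp_all add: mult.assoc)
  next
    case False
    obtain \<phi> Y where \<phi>: "encodes_at_most \<phi> X Y k" "card \<phi> \<le> 14 * card X" "card Y \<le> 5 * card X"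
      using linear_at_most_encoding[OF assms(1) order_refl] by blast
    \<comment> \<open>Here \<open>n = r * r ^ k\<close> with \<open>r < k\<close>, so a linear-size
      formula already meets the bound.\<close>
    have "real n \<le> real k * N"
      unfolding rn[symmetric] N power_Suc using False r by (intro mult_right_mono) auto
    moreover have "real (card \<phi>) \<le> 14 * real n" "real (card Y) \<le> 5 * real n"
      using \<phi>(2,3) by (simp_all add: n_def)
    ultimately have "real (card \<phi>) \<le> 2 * real (card X) + 54 * (real k * N)"
      "real (card Y) \<le> 54 * (real k * N)"
      using n by (simp_all add: n_def)
    then show ?thesis
      using \<phi>(1) by (intro exI conjI) (simp_all add: mult.assoc)
  qed
qed

theorem theorem11:
  shows "\<exists>C :: real. \<forall>(n :: nat) (k :: nat) (xs :: nat list).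
    n \<ge> 1 \<longrightarrow> k \<ge> 1 \<longrightarrow> distinct xs \<longrightarrow> length xs = n \<longrightarrow>
    (\<exists>(\<phi> :: nat cnf) (Y :: nat set).
       encodes \<phi> xs Y (AtMost k) \<and>
       real (card \<phi>) \<le> 2 * real n + C * real k * real n powr (real k / (real k + 1)) \<and>
       real (card Y) \<le> C * real k * real n powr (real k / (real k + 1)))"
proof (intro exI[of _ 54] allI impI)
  fix n k :: nat and xs :: "nat list"
  assume "1 \<le> n" "1 \<le> k" "distinct xs" "length xs = n"
  then have card: "card (set xs) = n"
    by (simp add: distinct_card)
  then obtain \<phi> Y where "encodes_at_most \<phi> (set xs) Y k"
    "real (card \<phi>) \<le> 2 * real n + 54 * real k * real n powr (real k / (real k + 1))"
    "real (card Y) \<le> 54 * real k * real n powr (real k / (real k + 1))"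
    using at_most_encoding[of "set xs" k] \<open>1 \<le> n\<close> \<open>1 \<le> k\<close> by auto
  then show "\<exists>(\<phi> :: nat cnf) (Y :: nat set). encodes \<phi> xs Y (AtMost k) \<and>
       real (card \<phi>) \<le> 2 * real n + 54 * real k * real n powr (real k / (real k + 1)) \<and>
       real (card Y) \<le> 54 * real k * real n powr (real k / (real k + 1))"
    using encodes_at_most_imp_encodes[OF _ \<open>distinct xs\<close>] by blast
qed

end
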